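(* Let $G$ be a weighted digraph on $V=\{1,\dots,n\}$ with random walk Laplacian $\mathcal{L}=I-S$ and with exactly $k$ reaches $R_1,\dots,R_k$. Let $\{\gamma_m\}_{m=1}^k$ (columns) and $\{\bar\gamma_m\}_{m=1}^k$ (rows) be the bases of the right and left kernels of $\mathcal{L}$ described in the context, let $\Gamma^0$ be the $n\times k$ matrix with columns $\gamma_1,\dots,\gamma_k$, and let $\bar\Gamma^0$ be the $k\times n$ matrix with rows $\bar\gamma_1,\dots,\bar\gamma_k$. Then for every initial probability (row) vector $p^{(0)}$ of the random walk, and every initial condition $x^{(0)}\in\mathbb{R}^n$ of the consensus problem $\dot x=-\mathcal{L}x$ with solution $x^{(t)}$, $$\lim_{\ell\to\infty}\frac1\ell\sum_{i=0}^{\ell-1}p^{(0)}S^i=p^{(0)}\,\Gamma^0\bar\Gamma^0\quad\text{and}\quad\lim_{t\to\infty}x^{(t)}=\Gamma^0\bar\Gamma^0\,x^{(0)}.$$ Equivalently, $$\lim_{\ell\to\infty}\frac1\ell\sum_{i=0}^{\ell-1}S^i=\lim_{t\to\infty}e^{-\mathcal{L}t}=\Gamma^0\bar\Gamma^0.$$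
   Context: $G$ is a weakly connected (i.e. its underlying undirected graph is connected) weighted directed graph on $V=\{1,\dots,n\}$ with directed edge set $E\subseteq V\times V$; $ji\in E$ denotes an edge $j\to i$, carrying a weight $w_{ji}>0$. The adjacency matrix $Q$ has $Q_{ij}=w_{ji}$ if $ji\in E$ and $0$ otherwise; if row $i$ of $Q$ is zero, $Q_{ii}$ is replaced by $1$ (the result is still called $Q$). $D$ is the diagonal matrix with $D_{ii}=\sum_j Q_{ij}$, $S=D^{-1}Q$ (row stochastic), and $\mathcal{L}=I-S$ is the random walk Laplacian. The random walk on $G$ is $p^{(\ell+1)}=p^{(\ell)}S$. Write $j\rightsquigarrow i$ if there is a directed path from $j$ to $i$. The reachable set of $j$ is $R(j)=\{j\}\cup\{i: j\rightsquigarrow i\}$. A reach is a set of the form $R(j)$ that is maximal with respect to inclusion among all reachable sets. The distinct reaches are $R_1,\dots,R_k$; the exclusive part of $R_i$ is $H_i=R_i\setminus\bigcup_{j\ne i}R_j$, the common part is $C_i=R_i\setminus H_i$, and the cabal $B_i$ of $R_i$ is the set of its roots, i.e. of vertices $r\in R_i$ with $R(r)=R_i$. $\gamma_1,\dots,\gamma_k$ is the basis of the right kernel $\{x:\mathcal{L}x=0\}$ (column vectors; the kernel is known to have dimension $k$ and to possess such a basis) satisfying: $\gamma_i(v)=1$ for $v\in H_i$; $\gamma_i(v)\in(0,1)$ for $v\in C_i$; $\gamma_i(v)=0$ for $v\notin R_i$; $\sum_i\gamma_i$ is the all-ones vector. $\bar\gamma_1,\dots,\bar\gamma_k$ is the basis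 of the left kernel $\{p: p\mathcal{L}=0\}$ (row vectors) satisfying: $\bar\gamma_i(v)\ge0$ for all $v$; the support of $\bar\gamma_i$ is $B_i$; $\sum_v\bar\gamma_i(v)=1$. *)

theory Defs
  imports "HOL-Analysis.Analysis"
begin

text \<open>
  A weighted digraph on \<open>{1,\<dots>,n}\<close> is an edge relation \<open>E\<close> on a finite type \<open>'n\<close>
  together with a weight function \<open>w\<close> which is only relevant on \<open>E\<close>;
  \<open>(j, i) \<in> E\<close> is the edge \<open>j \<rightarrow> i\<close>. Loops are allowed.
\<close>

definition weighted_digraph :: "('n \<times> 'n) set \<Rightarrow> ('n \<times> 'n \<Rightarrow> real) \<Rightarrow> bool" where
  "weighted_digraph E w \<longleftrightarrow> (\<forall>e\<in>E. w e > 0)"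

definition weakly_connected :: "('n \<times> 'n) set \<Rightarrow> bool" where
  "weakly_connected E \<longleftrightarrow> (\<forall>i j. (i, j) \<in> (E \<union> E\<inverse>)\<^sup>*)"

text \<open>
  Row \<open>i\<close> of the adjacency matrix collects the weights of the edges entering \<open>i\<close>.
\<close>

definition raw_adjacency :: "('n::finite \<times> 'n) set \<Rightarrow> ('n \<times> 'n \<Rightarrow> real) \<Rightarrow> real^'n^'n" where
  "raw_adjacency E w = (\<chi> i j. if (j, i) \<in> E then w (j, i) else 0)"

definition adjacency :: "('n::finite \<times> 'n) set \<Rightarrow> ('n \<times> 'n \<Rightarrow> real) \<Rightarrow> real^'n^'n" where
  "adjacency E w =
     (\<chi> i j. if i = j \<and> row i (raw_adjacency E w) = 0 then 1 else raw_adjacency E w $ i $ j)"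

definition degree_matrix :: "('n::finite \<times> 'n) set \<Rightarrow> ('n \<times> 'n \<Rightarrow> real) \<Rightarrow> real^'n^'n" where
  "degree_matrix E w = (\<chi> i j. if i = j then (\<Sum>l\<in>UNIV. adjacency E w $ i $ l) else 0)"

definition walk_matrix :: "('n::finite \<times> 'n) set \<Rightarrow> ('n \<times> 'n \<Rightarrow> real) \<Rightarrow> real^'n^'n" where
  "walk_matrix E w = matrix_inv (degree_matrix E w) ** adjacency E w"

definition rw_laplacian :: "('n::finite \<times> 'n) set \<Rightarrow> ('n \<times> 'n \<Rightarrow> real) \<Rightarrow> real^'n^'n" where
  "rw_laplacian E w = mat 1 - walk_matrix E w"

definition reachable_set :: "('n \<times> 'n) set \<Rightarrow> 'n \<Rightarrow> 'n set" where
  "reachable_set E j = {j} \<union> {i. (j, i) \<in> E\<^sup>+}"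

definition reaches :: "('n \<times> 'n) set \<Rightarrow> 'n set set" where
  "reaches E = {R \<in> range (reachable_set E). \<forall>R' \<in> range (reachable_set E). R \<subseteq> R' \<longrightarrow> R' = R}"

definition exclusive_part :: "('n \<times> 'n) set \<Rightarrow> 'n set \<Rightarrow> 'n set" where
  "exclusive_part E R = R - \<Union>(reaches E - {R})"

definition common_part :: "('n \<times> 'n) set \<Rightarrow> 'n set \<Rightarrow> 'n set" where
  "common_part E R = R - exclusive_part E R"

definition cabal :: "('n \<times> 'n) set \<Rightarrow> 'n set \<Rightarrow> 'n set" where
  "cabal E R = {r \<in> R. reachable_set E r = R}"

definition indexed_basis :: "('k \<Rightarrow> 'v::real_vector) \<Rightarrow> 'v set \<Rightarrow> bool" where
  "indexed_basis b U \<longleftrightarrow> inj b \<and> independent (range b) \<and> span (range b) = U"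

text \<open>
  In the next two definitions \<open>R\<close> enumerates the reaches without repetition,
  so that the finite type \<open>'k\<close> plays the role of \<open>{1,\<dots>,k}\<close>.
\<close>

definition right_kernel_basis ::
  "('n::finite \<times> 'n) set \<Rightarrow> ('n \<times> 'n \<Rightarrow> real) \<Rightarrow> ('k::finite \<Rightarrow> 'n set) \<Rightarrow> ('k \<Rightarrow> real^'n) \<Rightarrow> bool" where
  "right_kernel_basis E w R \<gamma> \<longleftrightarrow>
     indexed_basis \<gamma> {x. rw_laplacian E w *v x = 0} \<and>
     (\<forall>m. (\<forall>v \<in> exclusive_part E (R m). \<gamma> m $ v = 1) \<and>
          (\<forall>v \<in> common_part E (R m). \<gamma> m $ v \<in> {0<..<1}) \<and>
          (\<forall>v. v \<notin> R m \<longrightarrow> \<gamma> m $ v = 0)) \<and>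
     (\<Sum>m\<in>UNIV. \<gamma> m) = (\<chi> v. 1)"

definition left_kernel_basis ::
  "('n::finite \<times> 'n) set \<Rightarrow> ('n \<times> 'n \<Rightarrow> real) \<Rightarrow> ('k::finite \<Rightarrow> 'n set) \<Rightarrow> ('k \<Rightarrow> real^'n) \<Rightarrow> bool" where
  "left_kernel_basis E w R \<gamma>' \<longleftrightarrow>
     indexed_basis \<gamma>' {p. p v* rw_laplacian E w = 0} \<and>
     (\<forall>m. (\<forall>v. \<gamma>' m $ v \<ge> 0) \<and>
          {v. \<gamma>' m $ v \<noteq> 0} = cabal E (R m) \<and>
          (\<Sum>v\<in>UNIV. \<gamma>' m $ v) = 1)"

definition columns_matrix :: "('k \<Rightarrow> real^'n) \<Rightarrow> real^'k^'n" where
  "columns_matrix c = (\<chi> v m. c m $ v)"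

definition rows_matrix :: "('k \<Rightarrow> real^'n) \<Rightarrow> real^'n^'k" where
  "rows_matrix r = (\<chi> m v. r m $ v)"

definition probability_vector :: "real^'n \<Rightarrow> bool" where
  "probability_vector p \<longleftrightarrow> (\<forall>v. p $ v \<ge> 0) \<and> (\<Sum>v\<in>UNIV. p $ v) = 1"

text \<open>
  The power operation that the type of vectors inherits from its multiplication is componentwise,
  and square matrices are not an instance of the class on which \<open>exp\<close> is defined; hence the
  powers and the exponential of a matrix are introduced separately.
\<close>

primrec matrix_pow :: "real^'n^'n \<Rightarrow> nat \<Rightarrow> real^'n^'n" where
  "matrix_pow A 0 = mat 1"
| "matrix_pow A (Suc l) = matrix_pow A l ** A"

definition matrix_exp :: "real^'n^'n \<Rightarrow> real^'n^'n" where
  "matrix_exp A = (\<Sum>l. (1 / fact l) *\<^sub>R matrix_pow A l)"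

definition consensus_solution ::
  "('n::finite \<times> 'n) set \<Rightarrow> ('n \<times> 'n \<Rightarrow> real) \<Rightarrow> real^'n \<Rightarrow> (real \<Rightarrow> real^'n) \<Rightarrow> bool" where
  "consensus_solution E w x0 x \<longleftrightarrow> x 0 = x0 \<and>
     (\<forall>t\<ge>0. (x has_vector_derivative - (rw_laplacian E w *v x t)) (at t within {0..}))"

end

theory Submission
  imports Defs
begin

text \<open>
  Put \<open>P = \<Gamma> ** \<Gamma>'\<close>. A cabal is contained in the exclusive part of its reach, since a root lying in
  a second reach would make its own reach non-maximal. As \<open>\<gamma>' m\<close> is a probability vector carried by
  the cabal of \<open>R m\<close>, and \<open>\<gamma> l\<close> is there identically \<open>1\<close> or \<open>0\<close> according to whether \<open>l = m\<close>,
  the two bases are biorthogonal (\<open>kernel_bases_biorthogonal\<close>). Hence \<open>P\<close> maps into the right kernel of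
  \<open>L = I - S\<close> and fixes every row vector of the left kernel. The latter says that \<open>x - P x\<close> is
  orthogonal to the left kernel, which is the orthogonal complement of the range of \<open>L\<close>; therefore
  \<open>x - P x = L y\<close> for some \<open>y\<close> (\<open>residual_in_range\<close>).

  It remains to see that both averaging procedures fix \<open>P x\<close>, which is clear, and kill \<open>L y\<close>.
  For the Cesaro means, \<open>S^i L y = S^i y - S^(i+1) y\<close> telescopes and the powers of a row-stochastic
  matrix are bounded, so that an error of order \<open>1/l\<close> is left. For the consensus flow,
  \<open>e^(-tL) = e^(-t) e^(tS)\<close> is the mean of \<open>S^k\<close> when \<open>k\<close> is Poisson distributed with parameter
  \<open>t\<close>. Shifting the index by one multiplies the Poisson weight of \<open>k\<close> by \<open>k / t\<close>, so
  \<open>e^(-tL) L y\<close> is the mean of \<open>(1 - k/t) S^k y\<close>. Its size is bounded by \<open>\<parallel>y\<parallel>\<close> times the mean of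
  \<open>\<bar>1 - k/t\<bar>\<close>, which is at most \<open>1 / sqrt t\<close> because the Poisson variance is \<open>t\<close>
  (\<open>flow_on_range_bound\<close>). This avoids any discussion of the spectrum of \<open>S\<close>.

  Uniqueness of solutions of linear differential equations (\<open>linear_ode_unique\<close>) identifies the
  consensus solution with the matrix exponential, and is also what gives \<open>e^(-tL) = e^(-t) e^(tS)\<close>
  without a product formula for exponentials.
\<close>

section \<open>Row-stochastic matrices\<close>

definition row_stochastic :: "real^'n^'n \<Rightarrow> bool" where
  "row_stochastic S \<longleftrightarrow> (\<forall>i j. S $ i $ j \<ge> 0) \<and> (\<forall>i. (\<Sum>j\<in>UNIV. S $ i $ j) = 1)"

lemma matrix_pow_commute: "A ** matrix_pow A k = matrix_pow A k ** A"
  by (induction k) (simp_all add: matrix_mul_assoc)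

lemma matrix_pow_Suc_vec: "matrix_pow A (Suc k) *v x = A *v (matrix_pow A k *v x)"
  by (simp add: matrix_vector_mul_assoc matrix_pow_commute)

text \<open>Each entry of \<open>S x\<close> is a convex combination of the entries of \<open>x\<close>.\<close>

lemma row_stochastic_abs_le:
  assumes "row_stochastic S" and "\<And>j. \<bar>x $ j\<bar> \<le> c"
  shows "\<bar>(S *v x) $ i\<bar> \<le> c"
proof -
  have "\<bar>(S *v x) $ i\<bar> \<le> (\<Sum>j\<in>UNIV. \<bar>S $ i $ j * x $ j\<bar>)"
    by (simp add: matrix_vector_mult_def sum_abs)
  also have "\<dots> \<le> (\<Sum>j\<in>UNIV. S $ i $ j * c)"
    using assms by (intro sum_mono) (auto simp: row_stochastic_def abs_mult intro!: mult_left_mono)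
  also have "\<dots> = c"
    using assms(1) by (simp add: row_stochastic_def flip: sum_distrib_right)
  finally show ?thesis .
qed

lemma row_stochastic_pow_abs_le:
  assumes "row_stochastic S"
  shows "\<bar>(matrix_pow S k *v x) $ i\<bar> \<le> norm x"
proof (induction k arbitrary: i)
  case 0
  show ?case by (simp add: component_le_norm_cart)
next
  case (Suc k)
  show ?case
    unfolding matrix_pow_Suc_vec by (intro row_stochastic_abs_le assms Suc)
qed

section \<open>The matrix exponential as a flow\<close>

lemma matrix_pow_scaleR: "matrix_pow (c *\<^sub>R A) k = c ^ k *\<^sub>R matrix_pow A k"
  by (induction k) (simp_all add: matrix_scalar_ac mult.commute flip: scalar_matrix_assoc)

lemma matrix_pow_norm_le: "norm (matrix_pow A k *v x) \<le> onorm ((*v) A) ^ k * norm x"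
proof (induction k)
  case (Suc k)
  have "norm (matrix_pow A (Suc k) *v x) \<le> onorm ((*v) A) * norm (matrix_pow A k *v x)"
    unfolding matrix_pow_Suc_vec by (intro onorm matrix_vector_mul_bounded_linear)
  also have "\<dots> \<le> onorm ((*v) A) * (onorm ((*v) A) ^ k * norm x)"
    by (intro mult_left_mono Suc onorm_pos_le matrix_vector_mul_bounded_linear)
  finally show ?case by (simp add: mult.assoc)
qed simp

lemma entry_eq_axis: "(M *v axis j 1) $ i = (M $ i $ j :: real)"
  by (simp add: matrix_vector_mult_basis column_def)

lemma vec_sums_iff:
  fixes f :: "nat \<Rightarrow> 'a::real_normed_vector ^ 'n"
  shows "f sums s \<longleftrightarrow> (\<forall>i. (\<lambda>k. f k $ i) sums (s $ i))"
  unfolding sums_def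
  by (auto intro!: vec_tendstoI dest: tendsto_vec_nth simp flip: sum_component)

lemma matrix_exp_entry_summable: "summable (\<lambda>k. matrix_pow A k $ i $ j / fact k * t ^ k)"
proof (rule summable_comparison_test[OF exI, of 0])
  let ?K = "onorm ((*v) A)"
  show "summable (\<lambda>k. (?K * \<bar>t\<bar>) ^ k /\<^sub>R fact k)"
    by (rule summable_exp_generic)
  have "\<bar>matrix_pow A k $ i $ j\<bar> \<le> ?K ^ k" for k
    using component_le_norm_cart[of "matrix_pow A k *v axis j 1" i] matrix_pow_norm_le[of A k "axis j 1"]
    by (simp add: entry_eq_axis)
  then show "\<forall>k\<ge>0. norm (matrix_pow A k $ i $ j / fact k * t ^ k) \<le> (?K * \<bar>t\<bar>) ^ k /\<^sub>R fact k"
    by (auto simp: abs_mult power_mult_distrib power_abs field_simps intro!: mult_left_mono)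
qed

lemma matrix_exp_sums:
  "(\<lambda>k. (t ^ k / fact k) *\<^sub>R matrix_pow A k) sums matrix_exp (t *\<^sub>R A)"
proof -
  let ?f = "\<lambda>k. (t ^ k / fact k) *\<^sub>R matrix_pow A k"
  have "(\<lambda>k. ?f k $ i $ j) sums (\<Sum>k. matrix_pow A k $ i $ j / fact k * t ^ k)" for i j
    using summable_sums[OF matrix_exp_entry_summable[of A i j t]] by (simp add: mult_ac)
  then have "?f sums (\<chi> i j. \<Sum>k. matrix_pow A k $ i $ j / fact k * t ^ k)"
    by (simp add: vec_sums_iff)
  then show ?thesis
    by (simp add: matrix_exp_def matrix_pow_scaleR sums_iff)
qed

lemma linear_matrix_vector_mult_left: "linear (\<lambda>M :: real^'n^'m. M *v x)"
  by (intro linearI) (auto simp: matrix_vector_mult_add_rdistrib scaleR_matrix_vector_assoc)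

lemma matrix_exp_vector_sums:
  fixes x :: "real^'n"
  shows "(\<lambda>k. (t ^ k / fact k) *\<^sub>R (matrix_pow A k *v x)) sums (matrix_exp (t *\<^sub>R A) *v x)"
  using bounded_linear.sums[OF linear_matrix_vector_mult_left[unfolded linear_conv_bounded_linear, of x] matrix_exp_sums[of t A]]
  by (simp add: scaleR_matrix_vector_assoc)

lemma has_vector_derivative_vecI:
  fixes f :: "real \<Rightarrow> real^'n"
  assumes "\<And>i. ((\<lambda>t. f t $ i) has_real_derivative f' $ i) (at t within T)"
  shows "(f has_vector_derivative f') (at t within T)"
  unfolding has_vector_derivative_def
  by (subst has_derivative_componentwise_within)
    (use assms in \<open>auto simp: Basis_vec_def inner_axis has_field_derivative_def mult_commute_abs\<close>)

text \<open>
  In each coordinate the flow is an everywhere convergent real power series, so it can be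
  differentiated term by term; differentiating shifts the powers of \<open>A\<close> by one.
\<close>

lemma matrix_exp_has_vector_derivative:
  "((\<lambda>t. matrix_exp (t *\<^sub>R A) *v x) has_vector_derivative
     A *v (matrix_exp (t *\<^sub>R A) *v x)) (at t within T)"
proof (rule has_vector_derivative_vecI)
  fix i
  define c where "c k = (matrix_pow A k *v x) $ i / fact k" for k
  have sums: "(\<lambda>k. c k * t ^ k) sums ((matrix_exp (t *\<^sub>R A) *v x) $ i)" for t
    using matrix_exp_vector_sums[of t A x] by (simp add: vec_sums_iff c_def mult_ac)
  have "(\<lambda>k. (t ^ k / fact k) *\<^sub>R (A *v (matrix_pow A k *v x))) sums (A *v (matrix_exp (t *\<^sub>R A) *v x))"
    using bounded_linear.sums[OF matrix_vector_mul_bounded_linear matrix_exp_vector_sums]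
    by (simp add: matrix_vector_mult_scaleR)
  then have "(\<lambda>k. diffs c k * t ^ k) sums ((A *v (matrix_exp (t *\<^sub>R A) *v x)) $ i)"
    by (simp add: vec_sums_iff diffs_def c_def matrix_pow_Suc_vec mult.commute[of _ "t ^ _"]
        nonzero_divide_mult_cancel_left del: matrix_pow.simps(2) of_nat_Suc)
  moreover have "((\<lambda>t. \<Sum>k. c k * t ^ k) has_real_derivative (\<Sum>k. diffs c k * t ^ k)) (at t)"
    using sums by (intro termdiffs_strong_converges_everywhere) (auto simp: sums_iff)
  ultimately show "((\<lambda>t. (matrix_exp (t *\<^sub>R A) *v x) $ i) has_real_derivative
      (A *v (matrix_exp (t *\<^sub>R A) *v x)) $ i) (at t within T)"
    using sums by (auto simp: sums_iff intro: has_field_derivative_at_within)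
qed

lemma matrix_exp_zero: "matrix_exp (0 *\<^sub>R A) *v x = x"
proof -
  have "(\<lambda>k. (0 ^ k / fact k) *\<^sub>R (matrix_pow A k *v x)) sums ((0 ^ 0 / fact 0) *\<^sub>R (matrix_pow A 0 *v x))"
    using sums_finite[of "{0}" "\<lambda>k. (0 ^ k / fact k) *\<^sub>R (matrix_pow A k *v x)"] by auto
  then show ?thesis
    using matrix_exp_vector_sums[of 0 A x] by (auto dest: sums_unique2)
qed

text \<open>
  Energy estimate: with \<open>K\<close> the operator norm of \<open>A\<close>, the squared distance of two solutions satisfies
  \<open>(\<parallel>z\<parallel>\<^sup>2)' = 2 z \<bullet> A z \<le> 2 K \<parallel>z\<parallel>\<^sup>2\<close>, so \<open>e^(-2Kt) \<parallel>z\<parallel>\<^sup>2\<close> cannot grow from its initial value \<open>0\<close>.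
\<close>

lemma linear_ode_unique:
  fixes x y :: "real \<Rightarrow> real^'n"
  assumes x: "\<And>t. t \<ge> 0 \<Longrightarrow> (x has_vector_derivative A *v x t) (at t within {0..})"
    and y: "\<And>t. t \<ge> 0 \<Longrightarrow> (y has_vector_derivative A *v y t) (at t within {0..})"
    and "x 0 = y 0" "t \<ge> 0"
  shows "x t = y t"
proof -
  define z where "z t = x t - y t" for t
  define K where "K = onorm ((*v) A)"
  define q where "q t = exp (- (2 * K * t)) * (z t \<bullet> z t)" for t
  have dz: "(z has_vector_derivative A *v z t) (at t within {0..})" if "t \<ge> 0" for t
    unfolding z_def using has_vector_derivative_diff[OF x[OF that] y[OF that]]
    by (simp add: matrix_vector_mult_diff_distrib)
  have dq: "(q has_real_derivative
      exp (- (2 * K * t)) * (2 * (z t \<bullet> (A *v z t)) - 2 * K * (z t \<bullet> z t))) (at t within {0..})"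
    if "t \<ge> 0" for t
    using dz[OF that] unfolding q_def has_vector_derivative_def has_field_derivative_def
    by (auto intro!: derivative_eq_intros simp: algebra_simps inner_commute)
  have "q t \<le> q 0"
  proof (cases "t = 0")
    case False
    show ?thesis
    proof (rule DERIV_nonpos_imp_decreasing_open[of 0 t])
      show "continuous_on {0..t} q"
        by (rule continuous_on_subset[of "{0..}"], rule DERIV_continuous_on[OF dq]) auto
      fix s assume s: "0 < s" "s < t"
      have "z s \<bullet> (A *v z s) \<le> norm (z s) * norm (A *v z s)"
        by (rule norm_cauchy_schwarz)
      also have "\<dots> \<le> norm (z s) * (K * norm (z s))"
        unfolding K_def by (intro mult_left_mono onorm matrix_vector_mul_bounded_linear) simp
      finally have "2 * (z s \<bullet> (A *v z s)) - 2 * K * (z s \<bullet> z s) \<le> 0"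
        by (simp add: dot_square_norm power2_eq_square mult_ac)
      moreover have "at s within {0..} = at s"
        using s by (intro at_within_interior) simp
      ultimately show "\<exists>d. DERIV q s :> d \<and> d \<le> 0"
        using dq[of s] s by (auto intro!: exI mult_nonneg_nonpos)
    qed (use assms in auto)
  qed simp
  then have "z t \<bullet> z t \<le> 0"
    using \<open>x 0 = y 0\<close> by (simp add: q_def z_def mult_le_0_iff)
  then have "z t = 0"
    by (metis inner_gt_zero_iff not_le)
  then show ?thesis by (simp add: z_def)
qed

lemma matrix_exp_minus_id:
  assumes "t \<ge> 0"
  shows "matrix_exp (t *\<^sub>R (S - mat 1)) *v x = exp (- t) *\<^sub>R (matrix_exp (t *\<^sub>R S) *v x)"
proof (rule linear_ode_unique[where A = "S - mat 1" and t = t])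
  fix s :: real
  show "((\<lambda>t. matrix_exp (t *\<^sub>R (S - mat 1)) *v x) has_vector_derivative
      (S - mat 1) *v (matrix_exp (s *\<^sub>R (S - mat 1)) *v x)) (at s within {0..})"
    by (rule matrix_exp_has_vector_derivative)
  have "((\<lambda>t. exp (- t)) has_real_derivative - exp (- s)) (at s within {0..})"
    by (auto intro!: derivative_eq_intros)
  from has_vector_derivative_scaleR[OF this matrix_exp_has_vector_derivative[of S x]]
  show "((\<lambda>t. exp (- t) *\<^sub>R (matrix_exp (t *\<^sub>R S) *v x)) has_vector_derivative
      (S - mat 1) *v (exp (- s) *\<^sub>R (matrix_exp (s *\<^sub>R S) *v x))) (at s within {0..})"
    by (simp add: matrix_vector_mult_diff_rdistrib matrix_vector_mult_scaleR scaleR_diff_right)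
qed (use assms matrix_exp_zero[of S] matrix_exp_zero[of "S - mat 1"] in auto)

section \<open>Decay of the flow on the range of the Laplacian\<close>

text \<open>
  For \<open>b = 1\<close> and \<open>b k = k - 1\<close> this yields the first two factorial moments of the Poisson weights;
  for \<open>b k = (S^k y) $ i\<close> it rewrites the flow of \<open>S y\<close> in terms of the powers applied to \<open>y\<close>.
\<close>

lemma exp_series_index_shift:
  fixes t :: real
  assumes "(\<lambda>k. t ^ k / fact k * b (Suc k)) sums s"
  shows "(\<lambda>k. real k * (t ^ k / fact k) * b k) sums (t * s)"
proof (rule sums_Suc_imp)
  have "real (Suc k) * (t ^ Suc k / fact (Suc k)) = t * (t ^ k / fact k)" for k
    unfolding fact_Suc by (simp del: of_nat_Suc)
  then show "(\<lambda>k. real (Suc k) * (t ^ Suc k / fact (Suc k)) * b (Suc k)) sums (t * s)"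
    using sums_mult[OF assms, of t] by (simp only: mult.assoc)
qed simp

text \<open>After multiplication by \<open>t\<^sup>2 e^(-t)\<close> this says that the Poisson distribution has variance \<open>t\<close>.\<close>

lemma poisson_square_deviation_sums:
  fixes t :: real
  assumes "t > 0"
  shows "(\<lambda>k. t ^ k / fact k * (1 - real k / t)\<^sup>2) sums (exp t / t)"
proof -
  have e: "(\<lambda>k. t ^ k / fact k) sums exp t"
    using exp_converges[of t] by (simp add: field_simps)
  have m1: "(\<lambda>k. real k * (t ^ k / fact k)) sums (t * exp t)"
    using exp_series_index_shift[of t "\<lambda>_. 1"] e by simp
  have m2: "(\<lambda>k. (real k - 1) * real k * (t ^ k / fact k)) sums (t * (t * exp t))"
    using exp_series_index_shift[of t "\<lambda>k. real k - 1" "t * exp t"] m1 by (simp add: mult_ac)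
  have "(\<lambda>k. t ^ k / fact k - 2 / t * (real k * (t ^ k / fact k)) +
      1 / t\<^sup>2 * ((real k - 1) * real k * (t ^ k / fact k) + real k * (t ^ k / fact k)))
    sums (exp t - 2 / t * (t * exp t) + 1 / t\<^sup>2 * (t * (t * exp t) + t * exp t))"
    by (intro sums_add sums_diff sums_mult e m1 m2)
  moreover have "t ^ k / fact k - 2 / t * (real k * (t ^ k / fact k)) +
      1 / t\<^sup>2 * ((real k - 1) * real k * (t ^ k / fact k) + real k * (t ^ k / fact k))
    = t ^ k / fact k * (1 - real k / t)\<^sup>2" for k
  proof -
    have "p - 2 / t * (r * p) + 1 / t\<^sup>2 * ((r - 1) * r * p + r * p) = p * (1 - r / t)\<^sup>2" for p r
      using assms by (simp add: field_simps power2_eq_square)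
    then show ?thesis .
  qed
  moreover have "exp t - 2 / t * (t * exp t) + 1 / t\<^sup>2 * (t * (t * exp t) + t * exp t) = exp t / t"
    using assms by (simp add: field_simps power2_eq_square)
  ultimately show ?thesis by simp
qed

text \<open>
  The mean of \<open>\<bar>1 - k/t\<bar>\<close> is controlled by the mean of its square through the inequality of
  arithmetic and geometric means, weighted with \<open>sqrt t\<close> so that both terms have mean \<open>1 / sqrt t\<close>.
\<close>

lemma flow_on_range_bound:
  assumes "row_stochastic S" and "t > 0"
  shows "\<bar>(exp (- t) *\<^sub>R (matrix_exp (t *\<^sub>R S) *v (y - S *v y))) $ i\<bar> \<le> norm y / sqrt t"
proof -
  define b where "b k = (matrix_pow S k *v y) $ i" for k
  have b: "\<bar>b k\<bar> \<le> norm y" for k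
    unfolding b_def by (rule row_stochastic_pow_abs_le[OF assms(1)])
  have s0: "(\<lambda>k. t ^ k / fact k * b k) sums ((matrix_exp (t *\<^sub>R S) *v y) $ i)"
    using matrix_exp_vector_sums[of t S y] by (simp add: vec_sums_iff b_def)
  have "(\<lambda>k. t ^ k / fact k * b (Suc k)) sums ((matrix_exp (t *\<^sub>R S) *v (S *v y)) $ i)"
    using matrix_exp_vector_sums[of t S "S *v y"]
    by (simp add: vec_sums_iff b_def matrix_vector_mul_assoc)
  then have s1: "(\<lambda>k. t ^ k / fact k * (real k / t) * b k) sums ((matrix_exp (t *\<^sub>R S) *v (S *v y)) $ i)"
    using sums_divide[OF exp_series_index_shift, of t b _ t] assms(2) by (simp add: mult_ac)
  have d: "(\<lambda>k. t ^ k / fact k * (1 - real k / t) * b k)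
      sums ((matrix_exp (t *\<^sub>R S) *v (y - S *v y)) $ i)"
    using sums_diff[OF s0 s1]
    by (simp add: matrix_vector_mult_diff_distrib left_diff_distrib right_diff_distrib)
  have e: "(\<lambda>k. t ^ k / fact k) sums exp t"
    using exp_converges[of t] by (simp add: field_simps)
  let ?g = "\<lambda>k. norm y / 2 * (1 / sqrt t * (t ^ k / fact k) +
      sqrt t * (t ^ k / fact k * (1 - real k / t)\<^sup>2))"
  have g: "?g sums (norm y / 2 * (1 / sqrt t * exp t + sqrt t * (exp t / t)))"
    by (intro sums_mult sums_add e poisson_square_deviation_sums assms)
  have "norm (t ^ k / fact k * (1 - real k / t) * b k) \<le> ?g k" for k
  proof -
    have amgm: "\<bar>r\<bar> \<le> (1 / sqrt t + sqrt t * r\<^sup>2) / 2" for r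
    proof -
      have "0 \<le> (1 - sqrt t * \<bar>r\<bar>)\<^sup>2 / sqrt t" using assms by simp
      also have "\<dots> = 1 / sqrt t + sqrt t * r\<^sup>2 - 2 * \<bar>r\<bar>"
        using assms by (simp add: power2_diff power_mult_distrib field_simps)
      finally show ?thesis by simp
    qed
    have "norm (t ^ k / fact k * (1 - real k / t) * b k)
        = t ^ k / fact k * (\<bar>1 - real k / t\<bar> * \<bar>b k\<bar>)"
      using assms by (simp add: abs_mult)
    also have "\<dots> \<le> t ^ k / fact k * ((1 / sqrt t + sqrt t * (1 - real k / t)\<^sup>2) / 2 * norm y)"
      using assms by (intro mult_left_mono mult_mono amgm b) auto
    also have "\<dots> = ?g k" by (simp add: algebra_simps add_divide_distrib)
    finally show ?thesis .
  qed
  then have "norm (\<Sum>k. t ^ k / fact k * (1 - real k / t) * b k) \<le> suminf ?g"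
    using g by (intro norm_suminf_le) (auto simp: sums_iff)
  then have "\<bar>(matrix_exp (t *\<^sub>R S) *v (y - S *v y)) $ i\<bar>
      \<le> norm y / 2 * (1 / sqrt t * exp t + sqrt t * (exp t / t))"
    using d g by (simp add: sums_iff)
  also have "\<dots> = exp t * (norm y / sqrt t)"
    using assms by (simp add: field_simps)
  finally show ?thesis
    by (simp add: abs_mult exp_minus field_simps)
qed

section \<open>Convergence to the projection onto the kernel\<close>

text \<open>
  The component of \<open>x - P x\<close> orthogonal to the range of \<open>L\<close> is a vector \<open>z\<close> of the left kernel, and
  \<open>z \<bullet> P x = (z P) \<bullet> x = z \<bullet> x\<close>; hence \<open>z\<close> is also orthogonal to \<open>x - P x\<close> and vanishes.
\<close>

lemma residual_in_range:
  fixes L P :: "real^'n^'n"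
  assumes "\<And>p. p v* L = 0 \<Longrightarrow> p v* P = p"
  obtains y where "x - P *v x = L *v y"
proof -
  let ?U = "range ((*v) L)"
  have U: "subspace ?U" by (intro linear_subspace_image) auto
  obtain u z where u: "u \<in> span ?U" and z: "\<And>w. w \<in> span ?U \<Longrightarrow> orthogonal z w"
    and split: "x - P *v x = u + z"
    using orthogonal_subspace_decomp_exists by blast
  have "(z v* L) \<bullet> v = 0" for v
    using z[of "L *v v"] by (simp add: dot_lmul_matrix orthogonal_def span_base)
  then have "z v* L = 0" by (metis inner_eq_zero_iff)
  then have "z v* P = z" by (rule assms)
  then have "z \<bullet> (x - P *v x) = 0"
    by (simp add: inner_diff_right flip: dot_lmul_matrix)
  then have "z = 0"
    using z[OF u] by (simp add: split orthogonal_def inner_add_right)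
  then show ?thesis
    using that u split U by (auto simp: span_eq_iff[THEN iffD2])
qed

lemma matrix_tendstoI:
  fixes M :: "'a \<Rightarrow> real^'n^'m"
  assumes "\<And>x. ((\<lambda>a. M a *v x) \<longlongrightarrow> P *v x) F"
  shows "(M \<longlongrightarrow> P) F"
proof (intro vec_tendstoI)
  fix i j
  show "((\<lambda>a. M a $ i $ j) \<longlongrightarrow> P $ i $ j) F"
    using tendsto_vec_nth[OF assms[of "axis j 1"], of i] by (simp add: entry_eq_axis)
qed

lemma cesaro_mean_tendsto:
  assumes S: "row_stochastic S" and P: "S ** P = P"
    and left: "\<And>p. p v* (mat 1 - S) = 0 \<Longrightarrow> p v* P = p"
  shows "(\<lambda>l. (1 / real l) *\<^sub>R (\<Sum>i<l. matrix_pow S i)) \<longlonglongrightarrow> P"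
proof (rule matrix_tendstoI)
  fix x
  obtain y where y: "x - P *v x = (mat 1 - S) *v y"
    using residual_in_range[OF left] by blast
  have fixed: "matrix_pow S i *v (P *v x) = P *v x" for i
  proof (induction i)
    case (Suc i)
    have "S *v (P *v x) = P *v x" by (simp add: matrix_vector_mul_assoc P)
    with Suc show ?case by (simp only: matrix_pow_Suc_vec)
  qed simp
  have "matrix_pow S i *v x = P *v x + (matrix_pow S i *v y - matrix_pow S (Suc i) *v y)" for i
  proof -
    have "matrix_pow S i *v x = matrix_pow S i *v (P *v x) + matrix_pow S i *v (x - P *v x)"
      by (simp flip: matrix_vector_right_distrib)
    moreover have "matrix_pow S i *v (x - P *v x) = matrix_pow S i *v y - matrix_pow S (Suc i) *v y"
      by (simp add: y matrix_vector_mult_diff_distrib matrix_vector_mult_diff_rdistrib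
          matrix_vector_mul_assoc)
    ultimately show ?thesis by (simp only: fixed)
  qed
  then have sum: "(\<Sum>i<l. matrix_pow S i *v x) = real l *\<^sub>R (P *v x) + (y - matrix_pow S l *v y)" for l
    using sum_lessThan_telescope'[of "\<lambda>k. matrix_pow S k *v y" l]
    by (simp only: sum.distrib sum_constant_scaleR card_lessThan matrix_pow.simps(1) matrix_vector_mul_lid)
  have mean: "((1 / real l) *\<^sub>R (\<Sum>i<l. matrix_pow S i)) *v x
      = (1 / real l) *\<^sub>R (\<Sum>i<l. matrix_pow S i *v x)" for l
    using linear_sum[OF linear_matrix_vector_mult_left, of "matrix_pow S" "{..<l}" x]
    by (simp flip: scaleR_matrix_vector_assoc)
  show "(\<lambda>l. ((1 / real l) *\<^sub>R (\<Sum>i<l. matrix_pow S i)) *v x) \<longlonglongrightarrow> P *v x"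
  proof (rule vec_tendstoI)
    fix i
    \<comment> \<open>Both \<open>y\<close> and \<open>S^l y\<close> have entries of size at most \<open>\<parallel>y\<parallel>\<close>.\<close>
    have "(\<lambda>l. (1 / real l) * (y - matrix_pow S l *v y) $ i) \<longlonglongrightarrow> 0"
    proof (rule Lim_null_comparison)
      show "\<forall>\<^sub>F l in sequentially. norm ((1 / real l) * (y - matrix_pow S l *v y) $ i) \<le> 2 * norm y / real l"
      proof (rule always_eventually, rule allI)
        fix l
        have "\<bar>(y - matrix_pow S l *v y) $ i\<bar> \<le> 2 * norm y"
          using component_le_norm_cart[of y i] row_stochastic_pow_abs_le[OF S, of l y i] by simp
        then show "norm ((1 / real l) * (y - matrix_pow S l *v y) $ i) \<le> 2 * norm y / real l"
          by (simp add: divide_right_mono)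
      qed
      show "(\<lambda>l. 2 * norm y / real l) \<longlonglongrightarrow> 0" by (rule lim_const_over_n)
    qed
    from tendsto_add[OF tendsto_const[of "(P *v x) $ i"] this]
    have "(\<lambda>l. (P *v x) $ i + (1 / real l) * (y - matrix_pow S l *v y) $ i) \<longlonglongrightarrow> (P *v x) $ i"
      by simp
    \<comment> \<open>At \<open>l = 0\<close> the empty mean is \<open>0\<close> whatever \<open>P x\<close> is, so the identity needs \<open>l > 0\<close>.\<close>
    moreover have "\<forall>\<^sub>F l in sequentially. (P *v x) $ i + (1 / real l) * (y - matrix_pow S l *v y) $ i
        = (((1 / real l) *\<^sub>R (\<Sum>i<l. matrix_pow S i)) *v x) $ i"
      using eventually_gt_at_top[of 0] by eventually_elim (simp add: mean sum field_simps)
    ultimately show "(\<lambda>l. (((1 / real l) *\<^sub>R (\<Sum>i<l. matrix_pow S i)) *v x) $ i) \<longlonglongrightarrow> (P *v x) $ i"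
      by (rule Lim_transform_eventually)
  qed
qed

lemma consensus_tendsto:
  assumes S: "row_stochastic S" and P: "S ** P = P"
    and left: "\<And>p. p v* (mat 1 - S) = 0 \<Longrightarrow> p v* P = p"
  shows "((\<lambda>t. matrix_exp (t *\<^sub>R (S - mat 1)) *v x) \<longlongrightarrow> P *v x) at_top"
proof (rule vec_tendstoI)
  fix i
  obtain y where "x - P *v x = (mat 1 - S) *v y"
    using residual_in_range[OF left] by blast
  then have x: "x = P *v x + (y - S *v y)"
    by (simp add: matrix_vector_mult_diff_rdistrib algebra_simps)
  have stationary: "matrix_exp (t *\<^sub>R (S - mat 1)) *v (P *v x) = P *v x" if "t \<ge> 0" for t
  proof (rule linear_ode_unique[where A = "S - mat 1" and t = t and y = "\<lambda>_. P *v x"])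
    have "S *v (P *v x) = P *v x" by (simp add: matrix_vector_mul_assoc P)
    then have "(S - mat 1) *v (P *v x) = 0"
      by (simp only: matrix_vector_mult_diff_rdistrib matrix_vector_mul_lid) simp
    then show "((\<lambda>_. P *v x) has_vector_derivative (S - mat 1) *v (P *v x)) (at s within {0..})" for s
      by simp
  qed (use that matrix_exp_zero[of "S - mat 1"] in \<open>auto intro: matrix_exp_has_vector_derivative\<close>)
  have "((\<lambda>t. (exp (- t) *\<^sub>R (matrix_exp (t *\<^sub>R S) *v (y - S *v y))) $ i) \<longlongrightarrow> 0) at_top"
  proof (rule Lim_null_comparison)
    show "\<forall>\<^sub>F t in at_top. norm ((exp (- t) *\<^sub>R (matrix_exp (t *\<^sub>R S) *v (y - S *v y))) $ i)
        \<le> norm y / sqrt t"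
      using eventually_gt_at_top[of 0]
      by eventually_elim (use flow_on_range_bound[OF S] in auto)
    show "((\<lambda>t. norm y / sqrt t) \<longlongrightarrow> 0) at_top"
      by (intro real_tendsto_divide_at_top[OF tendsto_const] sqrt_at_top)
  qed
  from tendsto_add[OF tendsto_const[of "(P *v x) $ i"] this]
  have "((\<lambda>t. (P *v x) $ i + (exp (- t) *\<^sub>R (matrix_exp (t *\<^sub>R S) *v (y - S *v y))) $ i)
      \<longlongrightarrow> (P *v x) $ i) at_top" by simp
  moreover have "\<forall>\<^sub>F t in at_top. (P *v x) $ i + (exp (- t) *\<^sub>R (matrix_exp (t *\<^sub>R S) *v (y - S *v y))) $ i
      = (matrix_exp (t *\<^sub>R (S - mat 1)) *v x) $ i"
    using eventually_ge_at_top[of 0]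
  proof eventually_elim
    case (elim t)
    have "matrix_exp (t *\<^sub>R (S - mat 1)) *v x = matrix_exp (t *\<^sub>R (S - mat 1)) *v (P *v x)
        + matrix_exp (t *\<^sub>R (S - mat 1)) *v (y - S *v y)"
      by (subst x) (rule matrix_vector_right_distrib)
    then show ?case
      by (simp only: stationary[OF elim] matrix_exp_minus_id[OF elim, of S "y - S *v y"] vector_add_component)
  qed
  ultimately show "((\<lambda>t. (matrix_exp (t *\<^sub>R (S - mat 1)) *v x) $ i) \<longlongrightarrow> (P *v x) $ i) at_top"
    by (rule Lim_transform_eventually)
qed

section \<open>The walk on a weighted digraph\<close>

lemma matrix_inv_diagonal:
  fixes d :: "'n::finite \<Rightarrow> real"
  assumes "\<And>i. d i \<noteq> 0"
  shows "matrix_inv (\<chi> i j. if i = j then d i else 0) = (\<chi> i j. if i = j then 1 / d i else 0)"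
    (is "matrix_inv ?D = ?I")
proof -
  have "?D ** ?I = mat 1 \<and> ?I ** ?D = mat 1"
    using assms by (simp add: matrix_matrix_mult_def mat_def vec_eq_iff mult_delta_left)
  then have ex: "\<exists>B. ?D ** B = mat 1 \<and> B ** ?D = mat 1" and id: "?I ** ?D = mat 1" by blast+
  have "?D ** matrix_inv ?D = mat 1"
    unfolding matrix_inv_def using someI_ex[OF ex] by blast
  then have "?I ** (?D ** matrix_inv ?D) = ?I" by simp
  then show ?thesis by (simp only: matrix_mul_assoc id matrix_mul_lid)
qed

lemma walk_matrix_row_stochastic:
  assumes "weighted_digraph E w"
  shows "row_stochastic (walk_matrix E w)"
proof -
  define d where "d i = (\<Sum>l\<in>UNIV. adjacency E w $ i $ l)" for i
  have raw: "raw_adjacency E w $ i $ j \<ge> 0" for i j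
    using assms by (auto simp: raw_adjacency_def weighted_digraph_def less_imp_le)
  then have Q: "adjacency E w $ i $ j \<ge> 0" for i j
    by (simp add: adjacency_def)
  have "\<exists>j. adjacency E w $ i $ j > 0" for i
  proof (cases "row i (raw_adjacency E w) = 0")
    case True
    then show ?thesis by (intro exI[of _ i]) (simp add: adjacency_def)
  next
    case False
    then obtain j where "raw_adjacency E w $ i $ j \<noteq> 0"
      by (auto simp: row_def vec_eq_iff)
    with False raw[of i j] show ?thesis by (intro exI[of _ j]) (simp add: adjacency_def)
  qed
  then have d: "d i > 0" for i
    unfolding d_def using Q by (metis UNIV_I finite_class.finite_UNIV sum_pos2)
  have "degree_matrix E w = (\<chi> i j. if i = j then d i else 0)"
    by (simp add: vec_eq_iff degree_matrix_def d_def)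
  then have inv: "matrix_inv (degree_matrix E w) = (\<chi> i j. if i = j then 1 / d i else 0)"
    using matrix_inv_diagonal[of d] d by (simp add: less_imp_neq[symmetric])
  have "walk_matrix E w $ i $ j = adjacency E w $ i $ j / d i" for i j
    by (simp add: walk_matrix_def inv matrix_matrix_mult_def mult_delta_left)
  moreover have "(\<Sum>j\<in>UNIV. adjacency E w $ i $ j / d i) = 1" for i
    using d[of i] unfolding sum_divide_distrib[symmetric] d_def[symmetric] by simp
  ultimately show ?thesis
    unfolding row_stochastic_def using Q d by (simp add: less_imp_le)
qed

text \<open>A reach containing a root \<open>r\<close> contains everything reachable from \<open>r\<close>, that is, all of \<open>R\<close>.\<close>

lemma cabal_subset_exclusive_part:
  assumes "R \<in> reaches E"
  shows "cabal E R \<subseteq> exclusive_part E R"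
proof
  fix r assume "r \<in> cabal E R"
  then have r: "r \<in> R" "reachable_set E r = R" by (auto simp: cabal_def)
  have "R' = R" if "R' \<in> reaches E" "r \<in> R'" for R'
  proof -
    obtain s where s: "R' = reachable_set E s" using \<open>R' \<in> reaches E\<close> by (auto simp: reaches_def)
    then have "R \<subseteq> R'"
      using \<open>r \<in> R'\<close> r(2) by (auto simp: reachable_set_def intro: trancl_trans)
    then show ?thesis using assms that by (auto simp: reaches_def)
  qed
  then show "r \<in> exclusive_part E R" using r by (auto simp: exclusive_part_def)
qed

lemma kernel_bases_biorthogonal:
  assumes R: "bij_betw R UNIV (reaches E)"
    and right: "right_kernel_basis E w R \<gamma>" and left: "left_kernel_basis E w R \<gamma>'"
  shows "\<gamma>' m \<bullet> \<gamma> l = (if m = l then 1 else 0)"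
proof -
  have "\<gamma> l $ v = (if m = l then 1 else 0)" if v: "v \<in> cabal E (R m)" for v
  proof -
    have reach: "R m \<in> reaches E" "R l \<in> reaches E" using R by (auto simp: bij_betw_def)
    have excl: "v \<in> exclusive_part E (R m)"
      using cabal_subset_exclusive_part[OF reach(1)] v by auto
    show ?thesis
    proof (cases "m = l")
      case False
      then have "R l \<noteq> R m" using R by (auto simp: bij_betw_def inj_on_def)
      then have "v \<notin> R l" using excl reach by (auto simp: exclusive_part_def)
      then show ?thesis using False right by (simp add: right_kernel_basis_def)
    qed (use right excl in \<open>simp add: right_kernel_basis_def\<close>)
  qed
  moreover have "\<gamma>' m $ v \<noteq> 0 \<Longrightarrow> v \<in> cabal E (R m)" for v
    using left by (auto simp: left_kernel_basis_def)
  ultimately have "\<gamma>' m $ v * \<gamma> l $ v = \<gamma>' m $ v * (if m = l then 1 else 0)" for v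
    by (cases "\<gamma>' m $ v = 0") auto
  then have "\<gamma>' m \<bullet> \<gamma> l = (\<Sum>v\<in>UNIV. \<gamma>' m $ v) * (if m = l then 1 else 0)"
    unfolding inner_vec_def sum_distrib_right inner_real_def by (intro sum.cong refl)
  then show ?thesis using left by (simp add: left_kernel_basis_def)
qed

lemma columns_rows_vector:
  "(columns_matrix c ** rows_matrix r) *v x = (\<Sum>m\<in>UNIV. (r m \<bullet> x) *\<^sub>R c m)"
  unfolding matrix_vector_mul_assoc[symmetric]
  by (simp add: vec_eq_iff columns_matrix_def rows_matrix_def matrix_vector_mult_def inner_vec_def mult.commute)

lemma vector_columns_rows:
  "p v* (columns_matrix c ** rows_matrix r) = (\<Sum>m\<in>UNIV. (p \<bullet> c m) *\<^sub>R r m)"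
  unfolding vector_matrix_mul_assoc[symmetric]
  by (simp add: vec_eq_iff columns_matrix_def rows_matrix_def vector_matrix_mult_def inner_vec_def mult.commute)

lemma kernel_projection_fixed:
  assumes "right_kernel_basis E w R \<gamma>"
  shows "walk_matrix E w ** (columns_matrix \<gamma> ** rows_matrix \<gamma>')
    = columns_matrix \<gamma> ** rows_matrix \<gamma>'"
proof -
  let ?S = "walk_matrix E w" and ?P = "columns_matrix \<gamma> ** rows_matrix \<gamma>'"
  have "\<gamma> m \<in> {x. rw_laplacian E w *v x = 0}" for m
    using assms span_base[of "\<gamma> m" "range \<gamma>"] by (simp add: right_kernel_basis_def indexed_basis_def)
  then have "?S *v \<gamma> m = \<gamma> m" for m
    by (simp add: rw_laplacian_def matrix_vector_mult_diff_rdistrib)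
  then have "?S *v (?P *v x) = ?P *v x" for x
    by (simp add: columns_rows_vector matrix_vector_mult_scaleR linear_sum[OF matrix_vector_mul_linear])
  then show ?thesis
    by (simp add: matrix_eq matrix_vector_mul_assoc)
qed

text \<open>
  Both sides are linear in \<open>p\<close>, so it suffices to check the basis vectors \<open>\<gamma>' m\<close>, where biorthogonality
  leaves a single term of the sum.
\<close>

lemma kernel_projection_left:
  assumes R: "bij_betw R UNIV (reaches E)"
    and right: "right_kernel_basis E w R \<gamma>" and left: "left_kernel_basis E w R \<gamma>'"
    and p: "p v* rw_laplacian E w = 0"
  shows "p v* (columns_matrix \<gamma> ** rows_matrix \<gamma>') = p"
proof -
  have "p \<in> span (range \<gamma>')"
    using left p by (auto simp: left_kernel_basis_def indexed_basis_def)
  moreover have "linear (\<lambda>p. \<Sum>m\<in>UNIV. (p \<bullet> \<gamma> m) *\<^sub>R \<gamma>' m)"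
    by (intro linear_compose_sum ballI linearI) (auto simp: algebra_simps inner_add_left)
  moreover have "(\<Sum>m\<in>UNIV. (q \<bullet> \<gamma> m) *\<^sub>R \<gamma>' m) = q" if "q \<in> range \<gamma>'" for q
    using that by (auto simp: kernel_bases_biorthogonal[OF R right left] if_distrib if_distribR cong: if_cong)
  ultimately show ?thesis
    unfolding vector_columns_rows
    using linear_eq_on_span[of "\<lambda>p. \<Sum>m\<in>UNIV. (p \<bullet> \<gamma> m) *\<^sub>R \<gamma>' m" "\<lambda>p. p" "range \<gamma>'" p]
    by (auto simp: linear_id[unfolded id_def])
qed

theorem corollary5p5:
  fixes E :: "('n::finite \<times> 'n) set" and w :: "'n \<times> 'n \<Rightarrow> real"
    and R :: "'k::finite \<Rightarrow> 'n set" and \<gamma> \<gamma>' :: "'k \<Rightarrow> real^'n"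
    and \<Gamma> :: "real^'k^'n" and \<Gamma>' :: "real^'n^'k" and S L :: "real^'n^'n"
  assumes "weighted_digraph E w" and "weakly_connected E"
    and "bij_betw R UNIV (reaches E)"
    and "right_kernel_basis E w R \<gamma>" and "left_kernel_basis E w R \<gamma>'"
  defines "\<Gamma> \<equiv> columns_matrix \<gamma>" and "\<Gamma>' \<equiv> rows_matrix \<gamma>'"
    and "S \<equiv> walk_matrix E w" and "L \<equiv> rw_laplacian E w"
  shows "(\<forall>p0. probability_vector p0 \<longrightarrow>
            (\<lambda>l. (1 / real l) *\<^sub>R (\<Sum>i<l. p0 v* matrix_pow S i)) \<longlonglongrightarrow> p0 v* (\<Gamma> ** \<Gamma>')) \<and>
         (\<forall>x0 x. consensus_solution E w x0 x \<longrightarrow> (x \<longlongrightarrow> (\<Gamma> ** \<Gamma>') *v x0) at_top) \<and>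
         (\<lambda>l. (1 / real l) *\<^sub>R (\<Sum>i<l. matrix_pow S i)) \<longlonglongrightarrow> \<Gamma> ** \<Gamma>' \<and>
         ((\<lambda>t. matrix_exp (- (t *\<^sub>R L))) \<longlongrightarrow> \<Gamma> ** \<Gamma>') at_top"
proof -
  have L: "L = mat 1 - S" by (simp add: L_def S_def rw_laplacian_def)
  have neg: "- (t *\<^sub>R L) = t *\<^sub>R (S - mat 1)" for t by (simp add: L flip: scaleR_minus_right)
  have S: "row_stochastic S"
    unfolding S_def by (rule walk_matrix_row_stochastic) fact
  have P: "S ** (\<Gamma> ** \<Gamma>') = \<Gamma> ** \<Gamma>'"
    unfolding S_def \<Gamma>_def \<Gamma>'_def by (rule kernel_projection_fixed) fact
  have left: "p v* (\<Gamma> ** \<Gamma>') = p" if "p v* (mat 1 - S) = 0" for p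
    using kernel_projection_left[OF assms(3-5), of p] that
    by (simp add: S_def \<Gamma>_def \<Gamma>'_def rw_laplacian_def)
  have mean: "(\<lambda>l. (1 / real l) *\<^sub>R (\<Sum>i<l. matrix_pow S i)) \<longlonglongrightarrow> \<Gamma> ** \<Gamma>'"
    using S P left by (rule cesaro_mean_tendsto)
  have flow: "((\<lambda>t. matrix_exp (t *\<^sub>R (S - mat 1)) *v x) \<longlongrightarrow> (\<Gamma> ** \<Gamma>') *v x) at_top" for x
    using S P left by (rule consensus_tendsto)
  have "(\<lambda>l. (1 / real l) *\<^sub>R (\<Sum>i<l. p0 v* matrix_pow S i)) \<longlonglongrightarrow> p0 v* (\<Gamma> ** \<Gamma>')" for p0
  proof -
    have lin: "linear (\<lambda>M :: real^'n^'n. p0 v* M)"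
      by (intro linearI) (simp_all add: vec_eq_iff vector_matrix_mult_def algebra_simps sum.distrib sum_distrib_left)
    show ?thesis
      using bounded_linear.tendsto[OF lin[unfolded linear_conv_bounded_linear] mean]
      by (simp add: linear_cmul[OF lin] linear_sum[OF lin])
  qed
  moreover have "(x \<longlongrightarrow> (\<Gamma> ** \<Gamma>') *v x0) at_top" if sol: "consensus_solution E w x0 x" for x0 x
  proof -
    have "matrix_exp (t *\<^sub>R (S - mat 1)) *v x0 = x t" if "t \<ge> 0" for t
    proof (rule linear_ode_unique[where A = "S - mat 1" and t = t])
      fix s :: real assume "s \<ge> 0"
      moreover have "(S - mat 1) *v x s = - (rw_laplacian E w *v x s)"
        by (simp add: S_def rw_laplacian_def matrix_vector_mult_diff_rdistrib)
      ultimately show "(x has_vector_derivative (S - mat 1) *v x s) (at s within {0..})"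
        using sol by (simp add: consensus_solution_def)
    qed (use that sol matrix_exp_zero[of "S - mat 1"] in
        \<open>auto simp: consensus_solution_def intro: matrix_exp_has_vector_derivative\<close>)
    then have "\<forall>\<^sub>F t in at_top. matrix_exp (t *\<^sub>R (S - mat 1)) *v x0 = x t"
      by (rule eventually_at_top_linorderI)
    with flow show ?thesis by (rule Lim_transform_eventually)
  qed
  moreover have "((\<lambda>t. matrix_exp (- (t *\<^sub>R L))) \<longlongrightarrow> \<Gamma> ** \<Gamma>') at_top"
    unfolding neg by (rule matrix_tendstoI) (rule flow)
  ultimately show ?thesis using mean by blast
qed

end
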